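(* Let $S$ be a finite subset of a group $G$ and let $K$ be a positive real number such that $|SS^g|\leq K|S|$ for every $g\in G$. Then for every positive integer $m$ and all subsets $S_1,\dots,S_m$ of $G$, each of which is a conjugate (by an element of $G$) of either $S$ or $S^{-1}$, we have \[ |S_1\dotsb S_m|\leq K^{14(m-1)}|S|. \]
   Context: For a subset $S$ of a group $G$ and $g\in G$, $S^g=g^{-1}Sg$ and $S^{-1}=\{s^{-1}:s\in S\}$. The product of subsets is $A_1\dotsb A_m=\{a_1\dotsb a_m: a_i\in A_i\}$. *)

theory Defs
  imports Complex_Main "HOL-Algebra.Coset"
begin

definition set_conj :: "('a, 'b) monoid_scheme \<Rightarrow> 'a set \<Rightarrow> 'a \<Rightarrow> 'a set"
  where "set_conj G S g = (\<lambda>s. inv\<^bsub>G\<^esub> g \<otimes>\<^bsub>G\<^esub> s \<otimes>\<^bsub>G\<^esub> g) ` S"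

(* The product of a list of subsets; the empty product is the singleton of the identity. *)
definition set_prod_list :: "('a, 'b) monoid_scheme \<Rightarrow> 'a set list \<Rightarrow> 'a set"
  where "set_prod_list G As = foldr (\<lambda>A B. A <#>\<^bsub>G\<^esub> B) As {\<one>\<^bsub>G\<^esub>}"

end

theory Submission
  imports Defs
begin

text \<open>The proof bounds triple products and then deduces the bound for long products. Write n =
  |S| with S nonempty, so that K >= 1. Two conjugates P, Q of S satisfy |P Q| <= K n, since a common
  conjugation moves P to S. Ruzsa's triangle inequality (\<open>ruzsa_triangle\<close>) then gives
  |Q^{-1} P| <= K^2 n.

  The main step bounds A P C by K^8 n, where P is a conjugate of S and A, C are conjugates of S or
  S^{-1} (\<open>card_sandwich_le\<close>). Choose a nonempty X in P minimising |X P| / |X|. By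
  Petridis' inequality (\<open>petridis\<close>), |D X P| <= K |D X| for every finite D, while
  Ruzsa's covering lemma (\<open>ruzsa_covering\<close>) covers P by at most K^2 sets t X X^{-1}
  with t in P. Hence A P C lies in at most K^2 sets A t X X^{-1} C. By the triangle inequality with
  middle set P, each has size at most |A t X P| |C^{-1} X P| / n. Both factors are at most K^3 n: A
  t P is a left translate of A^t P, and this is where the hypothesis for all conjugates enters.
  Altogether this gives K^2 (K^3)^2 = K^8. If the middle factor is P^{-1}, invert the whole product.

  Finally, |A B R| <= |A B A| |A^{-1} R| / n shortens a product by one factor at the cost of K^8
  (\<open>card_set_prod_list_le\<close>). So m factors give K^(8(m-1)) n, which is at most the
  claimed bound because K >= 1.\<close>

context group
begin

section \<open>Inverses, translates and conjugates of sets\<close>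

lemma finite_set_mult: "finite A \<Longrightarrow> finite B \<Longrightarrow> finite (A <#> B)"
  by (simp add: set_mult_def)

lemma card_set_inv: "A \<subseteq> carrier G \<Longrightarrow> card (set_inv A) = card A"
proof -
  assume A: "A \<subseteq> carrier G"
  have "set_inv A = m_inv G ` A" by (auto simp: SET_INV_def)
  moreover have "inj_on (m_inv G) A" using inv_inj A inj_on_subset by metis
  ultimately show ?thesis by (simp add: card_image)
qed

lemma finite_set_inv: "finite A \<Longrightarrow> finite (set_inv A)"
  by (simp add: SET_INV_def)

lemma set_inv_closed: "A \<subseteq> carrier G \<Longrightarrow> set_inv A \<subseteq> carrier G"
  by (auto simp: SET_INV_def)

lemma set_inv_set_inv: "A \<subseteq> carrier G \<Longrightarrow> set_inv (set_inv A) = A"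
  by (auto simp: SET_INV_def subset_iff image_iff)

lemma set_inv_set_mult:
  assumes "A \<subseteq> carrier G" "B \<subseteq> carrier G"
  shows "set_inv (A <#> B) = set_inv B <#> set_inv A"
proof -
  have "inv (a \<otimes> b) = inv b \<otimes> inv a" if "a \<in> A" "b \<in> B" for a b
    using that assms inv_mult_group by blast
  then show ?thesis
    unfolding SET_INV_def set_mult_def by (auto; metis)
qed

lemma card_set_mult_set_inv:
  assumes "A \<subseteq> carrier G" "B \<subseteq> carrier G"
  shows "card (set_inv B <#> set_inv A) = card (A <#> B)"
  using assms card_set_inv set_inv_set_mult set_mult_closed by metis

lemma card_l_translate: "c \<in> carrier G \<Longrightarrow> A \<subseteq> carrier G \<Longrightarrow> card ((\<otimes>) c ` A) = card A"
  by (intro card_image inj_onI) (simp add: subset_iff)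

lemma card_le_card_set_mult:
  assumes "A \<subseteq> carrier G" "finite A" "A \<noteq> {}" "B \<subseteq> carrier G" "finite B"
  shows "card B \<le> card (A <#> B)"
proof -
  obtain a where a: "a \<in> A" using assms by blast
  then have "(\<otimes>) a ` B \<subseteq> A <#> B" by (auto simp: set_mult_def)
  then have "card ((\<otimes>) a ` B) \<le> card (A <#> B)"
    using assms by (intro card_mono finite_set_mult)
  then show ?thesis using card_l_translate[of a B] a assms by auto
qed

lemma set_conj_closed: "A \<subseteq> carrier G \<Longrightarrow> g \<in> carrier G \<Longrightarrow> set_conj G A g \<subseteq> carrier G"
  by (auto simp: set_conj_def)

lemma card_set_conj:
  assumes "A \<subseteq> carrier G" "g \<in> carrier G"
  shows "card (set_conj G A g) = card A"
  unfolding set_conj_def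
  using assms by (intro card_image inj_onI) (auto simp: subset_iff)

lemma set_conj_one: "A \<subseteq> carrier G \<Longrightarrow> set_conj G A \<one> = A"
  by (auto simp: set_conj_def subset_iff image_iff)

lemma set_conj_set_conj:
  assumes "A \<subseteq> carrier G" "g \<in> carrier G" "h \<in> carrier G"
  shows "set_conj G (set_conj G A g) h = set_conj G A (g \<otimes> h)"
proof -
  have "inv h \<otimes> (inv g \<otimes> a \<otimes> g) \<otimes> h = inv (g \<otimes> h) \<otimes> a \<otimes> (g \<otimes> h)" if "a \<in> A" for a
  proof -
    have "a \<in> carrier G" using that assms by blast
    then show ?thesis using assms by (simp add: inv_mult_group m_assoc)
  qed
  then show ?thesis by (force simp: set_conj_def image_image)
qed

lemma set_conj_set_inv:
  assumes "A \<subseteq> carrier G" "g \<in> carrier G"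
  shows "set_conj G (set_inv A) g = set_inv (set_conj G A g)"
proof -
  have "inv (inv g \<otimes> a \<otimes> g) = inv g \<otimes> inv a \<otimes> g" if "a \<in> A" for a
  proof -
    have "a \<in> carrier G" using that assms by blast
    then show ?thesis using assms by (simp add: inv_mult_group m_assoc)
  qed
  then show ?thesis by (force simp: set_conj_def SET_INV_def)
qed

lemma set_conj_set_mult:
  assumes "A \<subseteq> carrier G" "B \<subseteq> carrier G" "g \<in> carrier G"
  shows "set_conj G (A <#> B) g = set_conj G A g <#> set_conj G B g"
proof -
  have eq: "inv g \<otimes> (a \<otimes> b) \<otimes> g = (inv g \<otimes> a \<otimes> g) \<otimes> (inv g \<otimes> b \<otimes> g)"
    if "a \<in> A" "b \<in> B" for a b
  proof -
    have ab: "a \<in> carrier G" "b \<in> carrier G" using that assms by blast+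
    have "(inv g \<otimes> a \<otimes> g) \<otimes> (inv g \<otimes> b \<otimes> g) = inv g \<otimes> a \<otimes> (g \<otimes> inv g) \<otimes> b \<otimes> g"
      using ab assms(3) by (simp only: m_assoc m_closed inv_closed)
    then show ?thesis using ab assms(3) by (simp add: m_assoc)
  qed
  show ?thesis
    unfolding set_conj_def set_mult_def using eq by (auto simp: image_iff; metis)
qed

text \<open>An element t in the middle of a product can be pulled out to the left, where it does not
  affect cardinality, at the price of conjugating the factor it passes. This is how conjugates enter
  the argument.\<close>

lemma r_coset_eq_translate_set_conj:
  assumes "A \<subseteq> carrier G" "t \<in> carrier G"
  shows "A #> t = (\<otimes>) t ` set_conj G A t"
proof -
  have "t \<otimes> (inv t \<otimes> a \<otimes> t) = a \<otimes> t" if "a \<in> A" for a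
  proof -
    have "a \<in> carrier G" using that assms by blast
    then show ?thesis using assms by (simp add: m_assoc[symmetric])
  qed
  then show ?thesis by (force simp: r_coset_def set_conj_def)
qed

lemma card_r_coset_set_mult:
  assumes "A \<subseteq> carrier G" "B \<subseteq> carrier G" "t \<in> carrier G"
  shows "card ((A #> t) <#> B) = card (set_conj G A t <#> B)"
proof -
  have "t \<otimes> x \<otimes> b = t \<otimes> (x \<otimes> b)" if "x \<in> set_conj G A t" "b \<in> B" for x b
  proof -
    have "x \<in> carrier G" "b \<in> carrier G" using that assms set_conj_closed by blast+
    then show ?thesis using assms by (simp add: m_assoc)
  qed
  then have "(A #> t) <#> B = (\<otimes>) t ` (set_conj G A t <#> B)"
    unfolding r_coset_eq_translate_set_conj[OF assms(1,3)] set_mult_def by force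
  then show ?thesis
    using card_l_translate assms set_mult_closed set_conj_closed by metis
qed

section \<open>Product set inequalities of Ruzsa and Petridis\<close>

text \<open>Fix one factorisation x = a c for each x in A C and send (x, b) to (a b, b^{-1} c). The
  product of the two coordinates recovers x, hence a, and then the first coordinate recovers b, so
  the map is injective.\<close>

lemma ruzsa_triangle:
  assumes A: "A \<subseteq> carrier G" "finite A" and B: "B \<subseteq> carrier G" "finite B"
    and C: "C \<subseteq> carrier G" "finite C"
  shows "card (A <#> C) * card B \<le> card (A <#> B) * card (set_inv B <#> C)"
proof -
  have "\<forall>x\<in>A <#> C. \<exists>a c. a \<in> A \<and> c \<in> C \<and> x = a \<otimes> c"
    unfolding set_mult_def by blast
  then obtain p q where pq: "\<And>x. x \<in> A <#> C \<Longrightarrow> p x \<in> A \<and> q x \<in> C \<and> x = p x \<otimes> q x"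
    by metis
  let ?f = "\<lambda>(x, b). (p x \<otimes> b, inv b \<otimes> q x)"
  have "inj_on ?f ((A <#> C) \<times> B)"
  proof (rule inj_onI, clarify)
    fix x b y d
    assume x: "x \<in> A <#> C" "b \<in> B" and y: "y \<in> A <#> C" "d \<in> B"
      and e: "p x \<otimes> b = p y \<otimes> d" "inv b \<otimes> q x = inv d \<otimes> q y"
    have car: "p x \<in> carrier G" "q x \<in> carrier G" "b \<in> carrier G"
      "p y \<in> carrier G" "q y \<in> carrier G" "d \<in> carrier G"
      using pq x y A B C by blast+
    have fac: "u \<otimes> v = (u \<otimes> w) \<otimes> (inv w \<otimes> v)"
      if "u \<in> carrier G" "v \<in> carrier G" "w \<in> carrier G" for u v w
    proof -
      have "(u \<otimes> w) \<otimes> (inv w \<otimes> v) = u \<otimes> (w \<otimes> inv w) \<otimes> v"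
        using that by (simp only: m_assoc m_closed inv_closed)
      then show ?thesis using that by simp
    qed
    have "x = y"
      using pq[OF x(1)] pq[OF y(1)] fac[of "p x" "q x" b] fac[of "p y" "q y" d] e car by metis
    moreover from this e(1) car have "b = d" by simp
    ultimately show "x = y \<and> b = d" by simp
  qed
  moreover have "?f ` ((A <#> C) \<times> B) \<subseteq> (A <#> B) \<times> (set_inv B <#> C)"
  proof (clarify, intro conjI SigmaI)
    fix x b assume "x \<in> A <#> C" "b \<in> B"
    then show "p x \<otimes> b \<in> A <#> B" "inv b \<otimes> q x \<in> set_inv B <#> C"
      using pq[of x] unfolding set_mult_def SET_INV_def by blast+
  qed
  moreover have "finite ((A <#> B) \<times> (set_inv B <#> C))"
    using A B C by (intro finite_cartesian_product finite_set_mult finite_set_inv)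
  ultimately have "card ((A <#> C) \<times> B) \<le> card ((A <#> B) \<times> (set_inv B <#> C))"
    using card_inj_on_le by blast
  then show ?thesis by (simp add: card_cartesian_product)
qed

text \<open>Add the elements of C one at a time. A new c enlarges C X by c (X - Z), where Z consists
  of the x with c x already in C X. Since c Z B already lies in C X B, that product grows by at most
  |X B| - |Z B|, and minimality of X bounds |Z B| from below by |Z| |X B| / |X|.\<close>

lemma petridis:
  assumes X: "X \<subseteq> carrier G" "finite X" and B: "B \<subseteq> carrier G" "finite B"
    and C: "C \<subseteq> carrier G" "finite C"
    and min: "\<And>Z. Z \<subseteq> X \<Longrightarrow> card (X <#> B) * card Z \<le> card (Z <#> B) * card X"
  shows "card (C <#> X <#> B) * card X \<le> card (C <#> X) * card (X <#> B)"
  using C(2,1)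
proof (induction C rule: finite_induct)
  case empty
  then show ?case by (simp add: set_mult_def)
next
  case (insert c C)
  then have c: "c \<in> carrier G" and C: "C \<subseteq> carrier G" "finite C" by auto
  define Z where "Z = {x \<in> X. c \<otimes> x \<in> C <#> X}"
  have Z: "Z \<subseteq> X" "finite Z" using X by (auto simp: Z_def)
  have fin: "finite (C <#> X)" "finite (X <#> B)" "finite (C <#> X <#> B)"
    using C X B finite_set_mult by auto
  have ZB: "Z <#> B \<subseteq> X <#> B" using Z by (intro mono_set_mult) auto
  have "insert c C <#> X = (C <#> X) \<union> (\<otimes>) c ` (X - Z)"
    by (auto simp: set_mult_def Z_def)
  moreover have "(C <#> X) \<inter> (\<otimes>) c ` (X - Z) = {}" by (auto simp: Z_def)
  moreover have "card ((\<otimes>) c ` (X - Z)) = card (X - Z)"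
    using X by (intro card_l_translate[OF c]) auto
  ultimately have "card (insert c C <#> X) = card (C <#> X) + card (X - Z)"
    using fin X by (simp add: card_Un_disjoint)
  then have 1: "card (insert c C <#> X) + card Z = card (C <#> X) + card X"
    using card_Diff_subset[OF Z(2,1)] card_mono[OF X(2) Z(1)] by simp
  have "insert c C <#> X <#> B \<subseteq> (C <#> X <#> B) \<union> (\<otimes>) c ` ((X <#> B) - (Z <#> B))"
  proof
    fix y assume "y \<in> insert c C <#> X <#> B"
    then obtain d x b where y: "d \<in> insert c C" "x \<in> X" "b \<in> B" "y = d \<otimes> x \<otimes> b"
      by (auto simp: set_mult_def)
    show "y \<in> (C <#> X <#> B) \<union> (\<otimes>) c ` ((X <#> B) - (Z <#> B))"
    proof (cases "d \<in> C \<or> x \<otimes> b \<in> Z <#> B")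
      case True
      then show ?thesis
      proof
        assume "d \<in> C"
        then show ?thesis using y by (auto simp: set_mult_def)
      next
        \<comment> \<open>If x b = z b' with z in Z, then c x b = (c z) b', and c z is already in C
          X: nothing new arises.\<close>
        assume "x \<otimes> b \<in> Z <#> B"
        then obtain z b' where zb: "z \<in> Z" "b' \<in> B" "x \<otimes> b = z \<otimes> b'"
          by (auto simp: set_mult_def)
        have car: "d \<in> carrier G" "x \<in> carrier G" "b \<in> carrier G" "z \<in> carrier G" "b' \<in> carrier G"
          using y zb X B Z c C by auto
        show ?thesis
        proof (cases "d = c")
          case True
          then have "y = c \<otimes> z \<otimes> b'" using y(4) zb(3) car by (simp add: m_assoc)
          moreover have "c \<otimes> z \<in> C <#> X" using zb by (simp add: Z_def)
          ultimately show ?thesis using zb(2) unfolding set_mult_def[of G "C <#> X"] by blast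
        next
          case False
          then show ?thesis using y by (auto simp: set_mult_def)
        qed
      qed
    next
      case False
      then have "d = c" using y by auto
      moreover have "x \<in> carrier G" "b \<in> carrier G" using y X B by auto
      ultimately have "y = c \<otimes> (x \<otimes> b)" using y c by (simp add: m_assoc)
      moreover have "x \<otimes> b \<in> X <#> B" using y by (auto simp: set_mult_def)
      ultimately show ?thesis using False by auto
    qed
  qed
  then have "card (insert c C <#> X <#> B)
      \<le> card ((C <#> X <#> B) \<union> (\<otimes>) c ` ((X <#> B) - (Z <#> B)))"
    using fin by (intro card_mono) auto
  also have "\<dots> \<le> card (C <#> X <#> B) + card ((\<otimes>) c ` ((X <#> B) - (Z <#> B)))"
    by (rule card_Un_le)
  also have "card ((\<otimes>) c ` ((X <#> B) - (Z <#> B))) = card ((X <#> B) - (Z <#> B))"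
    using set_mult_closed[OF X(1) B(1)] by (intro card_l_translate[OF c]) auto
  finally have 2: "card (insert c C <#> X <#> B) + card (Z <#> B)
      \<le> card (C <#> X <#> B) + card (X <#> B)"
    using card_Diff_subset[OF finite_subset[OF ZB fin(2)] ZB] card_mono[OF fin(2) ZB] by simp
  \<comment> \<open>Fact 2 times |X|, fact 1 times |X B|, the induction hypothesis and minimality at
    Z combine linearly to the claim.\<close>
  have "card (insert c C <#> X <#> B) * card X + card (Z <#> B) * card X
      \<le> card (C <#> X <#> B) * card X + card (X <#> B) * card X"
    using mult_le_mono1[OF 2, of "card X"] by (simp add: algebra_simps)
  moreover have "card (insert c C <#> X) * card (X <#> B) + card Z * card (X <#> B)
      = card (C <#> X) * card (X <#> B) + card X * card (X <#> B)"
    using arg_cong[OF 1, of "\<lambda>n. n * card (X <#> B)"] by (simp add: algebra_simps)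
  moreover have "card (C <#> X <#> B) * card X \<le> card (C <#> X) * card (X <#> B)"
    using insert C by blast
  moreover note min[OF Z(1)]
  ultimately show ?case by (simp add: mult.commute)
qed

text \<open>Take T maximal in A such that the translates t X are pairwise disjoint. Disjointness
  inside A X bounds |T|. By maximality each a X meets some t X, which puts a in t X X^{-1}.\<close>

lemma ruzsa_covering:
  assumes A: "A \<subseteq> carrier G" "finite A" and X: "X \<subseteq> carrier G" "finite X" "X \<noteq> {}"
  obtains T where "T \<subseteq> A" "card T * card X \<le> card (A <#> X)" "A \<subseteq> T <#> (X <#> set_inv X)"
proof -
  let ?P = "\<lambda>T. T \<subseteq> A \<and> pairwise (\<lambda>s t. disjnt ((\<otimes>) s ` X) ((\<otimes>) t ` X)) T"
  have "finite {T. ?P T}" using A by (auto intro: finite_subset[of _ "Pow A"])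
  moreover have "?P {}" by simp
  ultimately obtain T where T: "?P T" and max: "\<And>T'. ?P T' \<Longrightarrow> T \<subseteq> T' \<Longrightarrow> T' = T"
    using finite_has_maximal[of "{T. ?P T}"] by (metis (mono_tags, lifting) empty_iff mem_Collect_eq)
  have finT: "finite T" using T A finite_subset by blast
  have "card (\<Union>t\<in>T. (\<otimes>) t ` X) = (\<Sum>t\<in>T. card ((\<otimes>) t ` X))"
    using T finT X by (intro card_UN_disjoint) (auto simp: pairwise_def disjnt_def)
  also have "\<dots> = (\<Sum>t\<in>T. card X)"
    using T A X by (intro sum.cong card_l_translate) auto
  finally have "card T * card X = card (\<Union>t\<in>T. (\<otimes>) t ` X)" by simp
  also have "\<dots> \<le> card (A <#> X)"
    using T A X by (intro card_mono finite_set_mult) (auto simp: set_mult_def)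
  finally have 1: "card T * card X \<le> card (A <#> X)" .
  have "A \<subseteq> T <#> (X <#> set_inv X)"
  proof
    fix a assume a: "a \<in> A"
    have "\<exists>t\<in>T. \<not> disjnt ((\<otimes>) a ` X) ((\<otimes>) t ` X)"
    proof (cases "a \<in> T")
      case True
      then show ?thesis using X by (auto simp: disjnt_def)
    next
      case False
      then have "\<not> ?P (insert a T)" using max[of "insert a T"] by blast
      then show ?thesis using T a by (auto simp: pairwise_insert disjnt_sym)
    qed
    then obtain t x y where t: "t \<in> T" "x \<in> X" "y \<in> X" "a \<otimes> x = t \<otimes> y"
      by (auto simp: disjnt_def)
    have car: "a \<in> carrier G" "t \<in> carrier G" "x \<in> carrier G" "y \<in> carrier G"
      using t a T A X by auto
    have "a = t \<otimes> (y \<otimes> inv x)"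
      using t(4) car by (metis inv_closed inv_solve_right m_assoc m_closed)
    then show "a \<in> T <#> (X <#> set_inv X)"
      using t unfolding set_mult_def SET_INV_def by auto
  qed
  with that T 1 show thesis by blast
qed

text \<open>X minimises |X B| / |X| over the nonempty subsets of S. Cross-multiplying admits Z
  empty, as \<open>petridis\<close> requires. Competitors range over S rather than only X, so Z = S
  compares the minimum with |S B| / |S|.\<close>

lemma petridis_minimizer:
  assumes S: "S \<subseteq> carrier G" "finite S" "S \<noteq> {}"
  obtains X where "X \<subseteq> S" "X \<noteq> {}"
    "\<And>Z. Z \<subseteq> S \<Longrightarrow> card (X <#> B) * card Z \<le> card (Z <#> B) * card X"
proof -
  let ?r = "\<lambda>X. real (card (X <#> B)) / real (card X)"
  let ?F = "{X. X \<subseteq> S \<and> X \<noteq> {}}"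
  have "finite ?F" "?F \<noteq> {}" using S by auto
  then obtain X where X: "X \<in> ?F" "\<And>Z. Z \<in> ?F \<Longrightarrow> ?r X \<le> ?r Z"
    using arg_min_if_finite(1)[of ?F ?r] arg_min_least[of ?F _ ?r] by blast
  have "card (X <#> B) * card Z \<le> card (Z <#> B) * card X" if Z: "Z \<subseteq> S" for Z
  proof (cases "Z = {}")
    case False
    have fin: "finite X" "finite Z" using X Z S finite_subset by blast+
    then have pos: "card X > 0" "card Z > 0" using X False by (auto simp: card_gt_0_iff)
    have "?r X \<le> ?r Z" using X Z False by blast
    then have "real (card (X <#> B)) * real (card Z) \<le> real (card (Z <#> B)) * real (card X)"
      using pos by (simp add: divide_simps mult.commute)
    then show ?thesis by (metis of_nat_le_iff of_nat_mult)
  qed simp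
  with that X show thesis by blast
qed

section \<open>Bounds for triple products and for long products\<close>

text \<open>The sandwiched \<open>S\<close> is covered by few translates \<open>t X X\<inverse>\<close>, where \<open>X\<close> minimises
  \<open>|X S| / |X|\<close> over the nonempty subsets of \<open>S\<close>; Ruzsa's inequality then splits \<open>(A t X) (X\<inverse> C)\<close>
  into two triple products to which Petridis' inequality applies.\<close>

lemma card_sandwich_le:
  fixes K L :: real
  assumes S: "S \<subseteq> carrier G" "finite S" "S \<noteq> {}" and A: "A \<subseteq> carrier G" "finite A"
    and C: "C \<subseteq> carrier G" "finite C"
    and SS: "real (card (S <#> S)) \<le> K * real (card S)"
    and AS: "\<And>t. t \<in> S \<Longrightarrow> real (card ((A #> t) <#> S)) \<le> L * real (card S)"
    and CS: "real (card (set_inv C <#> S)) \<le> L * real (card S)"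
  shows "real (card (A <#> S <#> C)) \<le> K ^ 4 * L ^ 2 * real (card S)"
proof -
  let ?n = "real (card S)"
  have n: "?n > 0" using S by (simp add: card_gt_0_iff)
  have "0 \<le> K * ?n" using SS by (meson of_nat_0_le_iff order_trans)
  then have K: "K \<ge> 0" using n by (simp add: zero_le_mult_iff)
  have "0 \<le> L * ?n" using CS by (meson of_nat_0_le_iff order_trans)
  then have L: "L \<ge> 0" using n by (simp add: zero_le_mult_iff)
  obtain X where X: "X \<subseteq> S" "X \<noteq> {}"
    and min: "\<And>Z. Z \<subseteq> S \<Longrightarrow> card (X <#> S) * card Z \<le> card (Z <#> S) * card X"
    using petridis_minimizer[OF S] by blast
  have XG: "X \<subseteq> carrier G" "finite X" using X S finite_subset by auto
  have x: "real (card X) > 0" using X XG by (simp add: card_gt_0_iff)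
  have "real (card (X <#> S)) * ?n \<le> real (card (S <#> S)) * real (card X)"
    using min[of S] by (metis of_nat_le_iff of_nat_mult subset_refl)
  also have "\<dots> \<le> (K * ?n) * real (card X)" using SS by (intro mult_right_mono) auto
  finally have XS: "real (card (X <#> S)) \<le> K * real (card X)" using n by simp
  \<comment> \<open>X has at least the fraction 1/K of the elements of S; this makes the covering
    below small.\<close>
  have "?n \<le> real (card (X <#> S))"
    using card_le_card_set_mult[OF XG X(2) S(1,2)] by simp
  with XS have nX: "?n \<le> K * real (card X)" by simp
  \<comment> \<open>Used for D = A t and D = C^{-1}: Petridis' inequality removes S at the cost of
    K, and X is then enlarged to S.\<close>
  have DXS: "real (card (D <#> X <#> S)) \<le> K * (L * ?n)"
    if D: "D \<subseteq> carrier G" "finite D" and DS: "real (card (D <#> S)) \<le> L * ?n" for D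
  proof -
    have "card (D <#> X <#> S) * card X \<le> card (D <#> X) * card (X <#> S)"
      using min X by (intro petridis XG S(1,2) D) blast
    then have "real (card (D <#> X <#> S)) * real (card X)
        \<le> real (card (D <#> X)) * real (card (X <#> S))"
      by (metis of_nat_le_iff of_nat_mult)
    also have "\<dots> \<le> real (card (D <#> X)) * (K * real (card X))"
      using XS by (intro mult_left_mono) auto
    finally have "real (card (D <#> X <#> S)) \<le> K * real (card (D <#> X))"
      using x by (simp add: mult.commute)
    also have "\<dots> \<le> K * real (card (D <#> S))"
      using K D S X by (intro mult_left_mono of_nat_mono card_mono finite_set_mult mono_set_mult) auto
    also have "\<dots> \<le> K * (L * ?n)" using DS K by (rule mult_left_mono)
    finally show ?thesis .
  qed
  obtain T where T: "T \<subseteq> S" "card T * card X \<le> card (S <#> X)" "S \<subseteq> T <#> (X <#> set_inv X)"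
    using ruzsa_covering[OF S(1,2) XG X(2)] .
  have finT: "finite T" using T S finite_subset by blast
  have iX: "set_inv X \<subseteq> carrier G" "finite (set_inv X)"
    using XG set_inv_closed finite_set_inv by auto
  have iC: "set_inv C \<subseteq> carrier G" "finite (set_inv C)"
    using C set_inv_closed finite_set_inv by auto
  have iXC: "set_inv X <#> C \<subseteq> carrier G" "finite (set_inv X <#> C)"
    using iX C set_mult_closed finite_set_mult by auto
  \<comment> \<open>|T| |X| <= |S X| <= K |S| <= K^2 |X|.\<close>
  have "card (S <#> X) \<le> card (S <#> S)"
    using S X by (intro card_mono finite_set_mult mono_set_mult) auto
  then have "real (card T * card X) \<le> K * ?n" using T(2) SS by linarith
  also have "\<dots> \<le> K * (K * real (card X))" using nX K by (rule mult_left_mono)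
  finally have cT: "real (card T) \<le> K ^ 2"
    using x by (simp add: power2_eq_square mult.assoc[symmetric])
  have piece: "real (card ((A #> t) <#> X <#> (set_inv X <#> C))) \<le> K\<^sup>2 * L\<^sup>2 * ?n"
    if t: "t \<in> T" for t
  proof -
    have tS: "t \<in> S" "t \<in> carrier G" using t T S by auto
    have At: "A #> t \<subseteq> carrier G" "finite (A #> t)"
      using A tS finite_set_mult[of A "{t}"] by (simp_all add: r_coset_subset_G flip: r_coset_eq_set_mult)
    have AtX: "(A #> t) <#> X \<subseteq> carrier G" "finite ((A #> t) <#> X)"
      using At XG set_mult_closed finite_set_mult by auto
    \<comment> \<open>Inversion brings the second factor of the triangle inequality into the form D
      X S with D = C^{-1}.\<close>
    have "set_inv S <#> (set_inv X <#> C) = set_inv (set_inv C <#> X <#> S)"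
      using S XG C iC iX by (simp add: set_inv_set_mult set_mult_closed set_inv_set_inv)
    then have e: "card (set_inv S <#> (set_inv X <#> C)) = card (set_inv C <#> X <#> S)"
      using S XG iC by (simp add: card_set_inv set_mult_closed)
    have "card ((A #> t) <#> X <#> (set_inv X <#> C)) * card S
        \<le> card ((A #> t) <#> X <#> S) * card (set_inv C <#> X <#> S)"
      using ruzsa_triangle[OF AtX S(1,2) iXC] e by simp
    then have "real (card ((A #> t) <#> X <#> (set_inv X <#> C))) * ?n
        \<le> real (card ((A #> t) <#> X <#> S)) * real (card (set_inv C <#> X <#> S))"
      by (metis of_nat_le_iff of_nat_mult)
    also have "\<dots> \<le> (K * (L * ?n)) * (K * (L * ?n))"
      using DXS[OF At AS[OF tS(1)]] DXS[OF iC CS] K L by (intro mult_mono) auto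
    also have "\<dots> = (K\<^sup>2 * L\<^sup>2 * ?n) * ?n" by (simp add: power2_eq_square)
    finally show ?thesis using n by simp
  qed
  have "A <#> S <#> C \<subseteq> A <#> (T <#> (X <#> set_inv X)) <#> C"
    using T by (intro mono_set_mult) auto
  also have "\<dots> = A <#> T <#> X <#> (set_inv X <#> C)"
  proof -
    have "T \<subseteq> carrier G" using T S by auto
    then show ?thesis using A XG iX C by (simp add: set_mult_assoc set_mult_closed)
  qed
  also have "\<dots> = (\<Union>t\<in>T. (A #> t) <#> X <#> (set_inv X <#> C))"
    unfolding set_mult_def r_coset_def by blast
  finally have "card (A <#> S <#> C) \<le> card (\<Union>t\<in>T. (A #> t) <#> X <#> (set_inv X <#> C))"
    using finT A XG iX C
    by (intro card_mono finite_UN_I finite_set_mult) (simp_all add: r_coset_def)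
  also have "\<dots> \<le> (\<Sum>t\<in>T. card ((A #> t) <#> X <#> (set_inv X <#> C)))"
    using finT by (rule card_UN_le)
  finally have "real (card (A <#> S <#> C)) \<le> (\<Sum>t\<in>T. real (card ((A #> t) <#> X <#> (set_inv X <#> C))))"
    by (metis of_nat_le_iff of_nat_sum)
  also have "\<dots> \<le> real (card T) * (K\<^sup>2 * L\<^sup>2 * ?n)"
    using piece by (rule sum_bounded_above)
  also have "\<dots> \<le> K\<^sup>2 * (K\<^sup>2 * L\<^sup>2 * ?n)"
    using cT by (intro mult_right_mono) auto
  also have "\<dots> = K ^ 4 * L ^ 2 * ?n" by (simp add: power2_eq_square power4_eq_xxxx)
  finally show ?thesis .
qed

lemma set_prod_list_Cons: "set_prod_list G (A # As) = A <#> set_prod_list G As"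
  by (simp add: set_prod_list_def)

lemma set_prod_list_closed:
  "(\<And>A. A \<in> set As \<Longrightarrow> A \<subseteq> carrier G) \<Longrightarrow> set_prod_list G As \<subseteq> carrier G"
  by (induction As) (auto simp: set_prod_list_Cons set_mult_closed, auto simp: set_prod_list_def)

lemma finite_set_prod_list:
  "(\<And>A. A \<in> set As \<Longrightarrow> finite A) \<Longrightarrow> finite (set_prod_list G As)"
  by (induction As) (auto simp: set_prod_list_Cons finite_set_mult, auto simp: set_prod_list_def)

text \<open>Ruzsa's inequality with middle set \<open>B = F\<close> trades the first two factors of a product for
  the single factor \<open>F\<inverse>\<close>, at the price of one triple product.\<close>

lemma card_set_prod_list_le:
  fixes L :: real
  assumes F: "\<And>A. A \<in> \<F> \<Longrightarrow> A \<subseteq> carrier G \<and> finite A \<and> card A = n \<and> set_inv A \<in> \<F>"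
    and triple: "\<And>A B C. A \<in> \<F> \<Longrightarrow> B \<in> \<F> \<Longrightarrow> C \<in> \<F> \<Longrightarrow> real (card (A <#> B <#> C)) \<le> L * real n"
    and "n > 0" "L \<ge> 0" "set As \<subseteq> \<F>" "As \<noteq> []"
  shows "real (card (set_prod_list G As)) \<le> L ^ (length As - 1) * real n"
  using assms(5,6)
proof (induction As rule: length_induct)
  case (1 As)
  then obtain A Bs where As: "As = A # Bs" by (cases As) auto
  with 1 have A: "A \<in> \<F>" and Bs: "set Bs \<subseteq> \<F>" by auto
  show ?case
  proof (cases Bs)
    case Nil
    have "A <#> {\<one>} = A" using F[OF A] by (force simp: set_mult_def)
    then show ?thesis using As Nil F[OF A] by (simp add: set_prod_list_def)
  next
    case (Cons B Rs)
    with Bs have B: "B \<in> \<F>" and Rs: "set Rs \<subseteq> \<F>" by auto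
    let ?R = "set_prod_list G Rs"
    have R: "?R \<subseteq> carrier G" "finite ?R"
      using set_prod_list_closed[of Rs] finite_set_prod_list[of Rs] Rs F by blast+
    have AB: "A <#> B \<subseteq> carrier G" "finite (A <#> B)"
      using F[OF A] F[OF B] by (simp_all add: set_mult_closed finite_set_mult)
    have eq: "set_prod_list G As = A <#> B <#> ?R"
      using F[OF A] F[OF B] R by (simp add: As Cons set_prod_list_Cons set_mult_assoc)
    \<comment> \<open>This list is one shorter than \<open>As\<close> but is not a tail of it, hence
      the induction on length and the closure of the family under inverses.\<close>
    have "real (card (set_prod_list G (set_inv A # Rs))) \<le> L ^ (length (set_inv A # Rs) - 1) * real n"
      using As Cons Rs F[OF A] by (intro 1(1)[rule_format]) auto
    then have IH: "real (card (set_inv A <#> ?R)) \<le> L ^ length Rs * real n"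
      by (simp add: set_prod_list_Cons)
    have "card (A <#> B <#> ?R) * card A \<le> card (A <#> B <#> A) * card (set_inv A <#> ?R)"
      using F[OF A] by (intro ruzsa_triangle AB R) auto
    then have "real (card (A <#> B <#> ?R)) * real n
        \<le> real (card (A <#> B <#> A)) * real (card (set_inv A <#> ?R))"
      using F[OF A] by (metis of_nat_le_iff of_nat_mult)
    also have "\<dots> \<le> (L * real n) * (L ^ length Rs * real n)"
      using triple[OF A B A] IH \<open>L \<ge> 0\<close> by (intro mult_mono) auto
    finally have "real (card (A <#> B <#> ?R)) \<le> L * L ^ length Rs * real n"
      using \<open>n > 0\<close> by simp
    then show ?thesis unfolding eq by (simp add: As Cons)
  qed
qed

end

section \<open>Conjugates of a set with small products, and their inverses\<close>

locale small_conjugates = group G for G (structure) +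
  fixes S :: "'a set" and K :: real
  assumes S: "S \<subseteq> carrier G" "finite S" "S \<noteq> {}"
    and small: "g \<in> carrier G \<Longrightarrow> real (card (S <#> set_conj G S g)) \<le> K * real (card S)"
begin

definition conjugates :: "'a set set" where "conjugates = set_conj G S ` carrier G"

lemma conjugatesD:
  assumes "P \<in> conjugates"
  shows "P \<subseteq> carrier G" "finite P" "card P = card S" "P \<noteq> {}"
proof -
  obtain g where g: "g \<in> carrier G" "P = set_conj G S g"
    using assms by (auto simp: conjugates_def)
  then show "P \<subseteq> carrier G" "card P = card S"
    using S by (simp_all add: set_conj_closed card_set_conj)
  show "finite P" "P \<noteq> {}"
    using g S by (simp_all add: set_conj_def)
qed

lemma S_conjugates: "S \<in> conjugates"
  using set_conj_one[OF S(1)] unfolding conjugates_def by force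

lemma set_conj_conjugates: "P \<in> conjugates \<Longrightarrow> g \<in> carrier G \<Longrightarrow> set_conj G P g \<in> conjugates"
  using S by (auto simp: conjugates_def set_conj_set_conj)

text \<open>Compare |S| with |S S|, the case g = 1. This allows powers of K to be weakened to higher
  ones.\<close>

lemma K_ge_1: "K \<ge> 1"
proof -
  have "card S \<le> card (S <#> S)"
    using S by (intro card_le_card_set_mult)
  with small[of \<one>] have "real (card S) \<le> K * real (card S)"
    by (simp add: set_conj_one[OF S(1)])
  moreover have "real (card S) > 0" using S by (simp add: card_gt_0_iff)
  ultimately show ?thesis by simp
qed

text \<open>Conjugation preserves cardinality, so S^g S^h has the size of S S^(h g^{-1}).\<close>

lemma card_mult_conjugates:
  assumes "P \<in> conjugates" "Q \<in> conjugates"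
  shows "real (card (P <#> Q)) \<le> K * real (card S)"
proof -
  obtain g h where g: "g \<in> carrier G" "P = set_conj G S g" and h: "h \<in> carrier G" "Q = set_conj G S h"
    using assms by (auto simp: conjugates_def)
  have "Q = set_conj G (set_conj G S (h \<otimes> inv g)) g"
    using S g h by (simp add: set_conj_set_conj m_assoc)
  then have "P <#> Q = set_conj G (S <#> set_conj G S (h \<otimes> inv g)) g"
    using S g h by (simp add: set_conj_set_mult set_conj_closed)
  then have "card (P <#> Q) = card (S <#> set_conj G S (h \<otimes> inv g))"
    using S g h by (simp add: card_set_conj set_mult_closed set_conj_closed)
  then show ?thesis using small[of "h \<otimes> inv g"] g h by simp
qed

definition signed_conjugates :: "'a set set"
  where "signed_conjugates = conjugates \<union> (\<lambda>P. set_inv P) ` conjugates"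

lemma signed_conjugatesD:
  assumes "A \<in> signed_conjugates"
  shows "A \<subseteq> carrier G" "finite A" "card A = card S" "set_inv A \<in> signed_conjugates"
proof -
  consider "A \<in> conjugates" | P where "P \<in> conjugates" "A = set_inv P"
    using assms by (auto simp: signed_conjugates_def)
  then have "A \<subseteq> carrier G \<and> finite A \<and> card A = card S \<and> set_inv A \<in> signed_conjugates"
    by cases (simp_all add: conjugatesD signed_conjugates_def set_inv_set_inv finite_set_inv
        card_set_inv set_inv_closed)
  then show "A \<subseteq> carrier G" "finite A" "card A = card S" "set_inv A \<in> signed_conjugates"
    by auto
qed

lemma set_conj_signed_conjugates:
  assumes "A \<in> signed_conjugates" "g \<in> carrier G"
  shows "set_conj G A g \<in> signed_conjugates"
  using assms conjugatesD set_conj_conjugates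
  by (auto simp: signed_conjugates_def set_conj_set_inv)

text \<open>For A = Q^{-1}, use the triangle inequality with middle set S^{-1}: the two products on
  the right have the sizes of S Q and S P, each costing a factor K.\<close>

lemma card_mult_signed_conjugates:
  assumes A: "A \<in> signed_conjugates" and P: "P \<in> conjugates"
  shows "real (card (A <#> P)) \<le> K\<^sup>2 * real (card S)"
proof -
  have n: "real (card S) > 0" using S by (simp add: card_gt_0_iff)
  consider "A \<in> conjugates" | Q where "Q \<in> conjugates" "A = set_inv Q"
    using A by (auto simp: signed_conjugates_def)
  then show ?thesis
  proof cases
    case 1
    then have "real (card (A <#> P)) \<le> K * real (card S)" using P by (rule card_mult_conjugates)
    also have "\<dots> \<le> K\<^sup>2 * real (card S)"
      using K_ge_1 by (intro mult_right_mono) (auto simp: power2_eq_square)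
    finally show ?thesis .
  next
    case 2
    have iS: "set_inv S \<subseteq> carrier G" "finite (set_inv S)"
      using S set_inv_closed finite_set_inv by auto
    have iQ: "set_inv Q \<subseteq> carrier G" "finite (set_inv Q)"
      using conjugatesD[OF 2(1)] set_inv_closed finite_set_inv by auto
    have "card (set_inv Q <#> P) * card (set_inv S)
        \<le> card (set_inv Q <#> set_inv S) * card (set_inv (set_inv S) <#> P)"
      using conjugatesD[OF P] by (intro ruzsa_triangle iS iQ) auto
    then have "card (A <#> P) * card S \<le> card (S <#> Q) * card (S <#> P)"
      using 2 S conjugatesD[OF 2(1)]
      by (simp add: card_set_inv set_inv_set_inv card_set_mult_set_inv)
    then have "real (card (A <#> P)) * real (card S) \<le> real (card (S <#> Q)) * real (card (S <#> P))"
      by (metis of_nat_le_iff of_nat_mult)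
    also have "\<dots> \<le> (K * real (card S)) * (K * real (card S))"
      using card_mult_conjugates[OF S_conjugates 2(1)] card_mult_conjugates[OF S_conjugates P] K_ge_1
      by (intro mult_mono) auto
    finally show ?thesis using n by (simp add: power2_eq_square)
  qed
qed

text \<open>The sandwich bound applies with a conjugate P in the role of S and L = K^2, giving K^4
  (K^2)^2. A middle factor P^{-1} is handled by inverting the product.\<close>

lemma card_triple_le:
  assumes A: "A \<in> signed_conjugates" and B: "B \<in> signed_conjugates" and C: "C \<in> signed_conjugates"
  shows "real (card (A <#> B <#> C)) \<le> K ^ 8 * real (card S)"
proof -
  have main: "real (card (A <#> P <#> C)) \<le> K ^ 8 * real (card S)"
    if A: "A \<in> signed_conjugates" and P: "P \<in> conjugates" and C: "C \<in> signed_conjugates" for A P C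
  proof -
    note P' = conjugatesD[OF P]
    have "real (card (A <#> P <#> C)) \<le> K ^ 4 * (K\<^sup>2)\<^sup>2 * real (card P)"
    proof (rule card_sandwich_le)
      fix t assume "t \<in> P"
      then have t: "t \<in> carrier G" using P' by auto
      \<comment> \<open>A t P has the size of A^t P, and A^t is again a conjugate of S or of
        S^{-1}.\<close>
      show "real (card ((A #> t) <#> P)) \<le> K\<^sup>2 * real (card P)"
        using card_mult_signed_conjugates[OF set_conj_signed_conjugates[OF A t] P]
          card_r_coset_set_mult[OF signed_conjugatesD(1)[OF A] P'(1) t] P' by simp
    qed (use P' signed_conjugatesD A C card_mult_conjugates[OF P P]
          card_mult_signed_conjugates[OF signed_conjugatesD(4)[OF C] P] in auto)
    then show ?thesis using P' by (simp flip: power_mult power_add)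
  qed
  consider "B \<in> conjugates" | P where "P \<in> conjugates" "B = set_inv P"
    using B by (auto simp: signed_conjugates_def)
  then show ?thesis
  proof cases
    case 1
    then show ?thesis using main A C by blast
  next
    case 2
    note P = conjugatesD[OF 2(1)]
    note A' = signed_conjugatesD[OF A] and C' = signed_conjugatesD[OF C]
    have "A <#> B <#> C = set_inv (set_inv C <#> P <#> set_inv A)"
      using 2 P A' C'
      by (simp add: set_inv_set_mult set_mult_closed set_inv_closed set_inv_set_inv set_mult_assoc)
    then have "card (A <#> B <#> C) = card (set_inv C <#> P <#> set_inv A)"
      using P A' C' by (simp add: card_set_inv set_mult_closed set_inv_closed)
    then show ?thesis using main[OF C'(4) 2(1) A'(4)] by simp
  qed
qed

end

theorem lemma6p1:
  fixes G :: "('a, 'b) monoid_scheme"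
    and S :: "'a set"
    and K :: real
    and m :: nat
    and Ss :: "'a set list"
  assumes "group G"
    and "S \<subseteq> carrier G"
    and "finite S"
    and "K > 0"
    and "\<And>g. g \<in> carrier G \<Longrightarrow> real (card (S <#>\<^bsub>G\<^esub> set_conj G S g)) \<le> K * real (card S)"
    and "m \<ge> 1"
    and "length Ss = m"
    and "\<And>T. T \<in> set Ss \<Longrightarrow>
           \<exists>g\<in>carrier G. T = set_conj G S g \<or> T = set_conj G (set_inv\<^bsub>G\<^esub> S) g"
  shows "real (card (set_prod_list G Ss)) \<le> K ^ (14 * (m - 1)) * real (card S)"
proof (cases "S = {}")
  case True
  \<comment> \<open>Since m >= 1 there is a factor, and it is empty; only the product of no factors
    would be the singleton of the identity.\<close>
  obtain T Ts where Ss: "Ss = T # Ts" using assms(6,7) by (cases Ss) auto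
  have "T = {}" using assms(8)[of T] Ss True by (auto simp: set_conj_def SET_INV_def)
  then show ?thesis by (simp add: Ss set_prod_list_def set_mult_def True)
next
  case False
  interpret group G by fact
  interpret small_conjugates G S K
    using assms(2,3,5) False by unfold_locales
  have "set Ss \<subseteq> signed_conjugates"
    using assms(8) S by (fastforce simp: signed_conjugates_def conjugates_def set_conj_set_inv)
  moreover have "Ss \<noteq> []" using assms(6,7) by auto
  ultimately have "real (card (set_prod_list G Ss)) \<le> (K ^ 8) ^ (length Ss - 1) * real (card S)"
    using signed_conjugatesD card_triple_le S K_ge_1
    by (intro card_set_prod_list_le[of signed_conjugates]) (auto simp: card_gt_0_iff)
  \<comment> \<open>The exponent 8(m-1) is at most 14(m-1), and K >= 1.\<close>
  also have "\<dots> \<le> K ^ (14 * (m - 1)) * real (card S)"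
    using K_ge_1 assms(7)
    by (intro mult_right_mono) (auto simp flip: power_mult intro!: power_increasing)
  finally show ?thesis .
qed

end
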